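(* Let $S$ be a finite set and let $(X_n)_{n\ge0}$ be a homogeneous Markov chain on $S$ with transition probabilities $p(x,y)$, $x,y\in S$, satisfying $$\kappa:=\min_{x,x'\in S}\sum_{y\in S}\min\bigl(p(x,y),p(x',y)\bigr)>0 .$$ Let $\mu$ be the unique invariant probability measure of the chain, and let $V$ be the non-negative linear operator on functions on $S\times S$ defined in the context, with spectral radius $r(V)$. Then for every $x\in S$, $$\limsup_{n\to\infty}\frac1n\ln\|P_x(n,\cdot)-\mu(\cdot)\|_{TV}\le\ln r(V).$$
   Context: $P_x(n,A)=\mathbb P_x(X_n\in A)$ is the $n$-step transition kernel. The total variation distance between probability measures is $\|\mu-\nu\|_{TV}:=2\sup_{A}(\mu(A)-\nu(A))$. Convention: $\ln 0=-\infty$. For $x^1,x^2\in S$ put $\kappa(x^1,x^2):=\sum_{t\in S}\min(p(x^1,t),p(x^2,t))$. For $(x^1,x^2)$ with $\kappa(x^1,x^2)<1$, let $(\eta^1_1,\eta^2_1)$ be, under $\mathbb E_{x^1,x^2}$, a pair of independent $S$-valued random variables with respective probability mass functions $$u\mapsto\frac{p(x^1,u)-\min(p(x^1,u),p(x^2,u))}{1-\kappa(x^1,x^2)},\qquad u\mapsto\frac{p(x^2,u)-\min(p(x^1,u),p(x^2,u))}{1-\kappa(x^1,x^2)} .$$ The operator $V$ acts on functions $h:S\times S\to\mathbb R$ by $$Vh(x^1,x^2):=(1-\kappa(x^1,x^2))\,\mathbb E_{x^1,x^2}h(\eta^1_1,\eta^2_1),$$ with $Vh(x^1,x^2):=0$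 when $\kappa(x^1,x^2)=1$. *)

theory Defs
  imports "HOL-Probability.Probability"
begin

text \<open>The state space is a finite type; \<open>pmf (p x) y\<close> is the transition probability from
  \<open>x\<close> to \<open>y\<close>. The Markov property is stated in product form, which avoids conditioning on
  null events.\<close>

definition markov_chain_from ::
    "('a \<Rightarrow> 'a pmf) \<Rightarrow> 'a \<Rightarrow> 'w measure \<Rightarrow> (nat \<Rightarrow> 'w \<Rightarrow> 'a) \<Rightarrow> bool" where
  "markov_chain_from p x M X \<longleftrightarrow>
     prob_space M \<and>
     (\<forall>n. X n \<in> M \<rightarrow>\<^sub>M count_space UNIV) \<and>
     measure M {\<omega> \<in> space M. X 0 \<omega> = x} = 1 \<and>
     (\<forall>n (s :: nat \<Rightarrow> 'a).
        measure M {\<omega> \<in> space M. \<forall>i\<le>Suc n. X i \<omega> = s i} =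
        measure M {\<omega> \<in> space M. \<forall>i\<le>n. X i \<omega> = s i} * pmf (p (s n)) (s (Suc n)))"

definition invariant_pmf :: "('a \<Rightarrow> 'a pmf) \<Rightarrow> 'a pmf \<Rightarrow> bool" where
  "invariant_pmf p \<mu> \<longleftrightarrow> bind_pmf \<mu> p = \<mu>"

text \<open>The normalisation has a factor 2, so the distance takes values in \<open>[0, 2]\<close>.\<close>

definition tv_dist :: "'a measure \<Rightarrow> 'a measure \<Rightarrow> real" where
  "tv_dist M N = 2 * (SUP A\<in>sets M. measure M A - measure N A)"

definition overlap :: "('a::finite \<Rightarrow> 'a pmf) \<Rightarrow> 'a \<Rightarrow> 'a \<Rightarrow> real" where
  "overlap p x x' = (\<Sum>t\<in>UNIV. min (pmf (p x) t) (pmf (p x') t))"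

definition min_overlap :: "('a::finite \<Rightarrow> 'a pmf) \<Rightarrow> real" where
  "min_overlap p = Min (range (\<lambda>(x, x'). overlap p x x'))"

text \<open>The law of \<open>\<eta>\<^sup>1\<close> for the pair \<open>(x, x')\<close>; the law of \<open>\<eta>\<^sup>2\<close> is
  \<open>residual_pmf p x' x\<close>. It is only meaningful if \<open>overlap p x x' < 1\<close>,
  see \<open>pmf_residual_pmf\<close> below.\<close>

definition residual_pmf :: "('a::finite \<Rightarrow> 'a pmf) \<Rightarrow> 'a \<Rightarrow> 'a \<Rightarrow> 'a pmf" where
  "residual_pmf p x x' = embed_pmf
     (\<lambda>u. (pmf (p x) u - min (pmf (p x) u) (pmf (p x') u)) / (1 - overlap p x x'))"

lemma overlap_commute: "overlap p x x' = overlap p x' x"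
  by (simp add: overlap_def min.commute)

lemma pmf_residual_pmf:
  assumes "overlap p x x' < 1"
  shows "pmf (residual_pmf p x x') u =
    (pmf (p x) u - min (pmf (p x) u) (pmf (p x') u)) / (1 - overlap p x x')"
  unfolding residual_pmf_def
proof (rule pmf_embed_pmf)
  let ?f = "\<lambda>u. (pmf (p x) u - min (pmf (p x) u) (pmf (p x') u)) / (1 - overlap p x x')"
  show nonneg: "0 \<le> ?f u" for u
    using assms by simp
  have "(\<Sum>u\<in>UNIV. pmf (p x) u) = 1"
    by (rule sum_pmf_eq_1) auto
  then have "(\<Sum>u\<in>UNIV. ?f u) = 1"
    using assms by (simp add: sum_divide_distrib[symmetric] sum_subtractf overlap_def)
  then show "(\<integral>\<^sup>+u. ennreal (?f u) \<partial>count_space UNIV) = 1"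
    using nonneg by (simp add: nn_integral_count_space_finite sum_ennreal)
qed

definition V_op :: "('a::finite \<Rightarrow> 'a pmf) \<Rightarrow> ('a \<times> 'a \<Rightarrow> real) \<Rightarrow> ('a \<times> 'a \<Rightarrow> real)" where
  "V_op p h = (\<lambda>(x, x').
     if overlap p x x' = 1 then 0
     else (1 - overlap p x x') *
       measure_pmf.expectation (pair_pmf (residual_pmf p x x') (residual_pmf p x' x)) h)"

text \<open>The spectral radius of a linear operator on the finite-dimensional real space of functions
  on a finite type: eigenvalues are taken in the complexification
  \<open>f + \<i> g \<mapsto> T f + \<i> T g\<close>.\<close>

definition complexification :: "(('b \<Rightarrow> real) \<Rightarrow> ('b \<Rightarrow> real)) \<Rightarrow> ('b \<Rightarrow> complex) \<Rightarrow> ('b \<Rightarrow> complex)" where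
  "complexification T h = (\<lambda>s. Complex (T (Re \<circ> h) s) (T (Im \<circ> h) s))"

definition op_spectrum :: "(('b::finite \<Rightarrow> real) \<Rightarrow> ('b \<Rightarrow> real)) \<Rightarrow> complex set" where
  "op_spectrum T = {c. \<exists>h. h \<noteq> (\<lambda>_. 0) \<and> complexification T h = (\<lambda>s. c * h s)}"

definition op_spectral_radius :: "(('b::finite \<Rightarrow> real) \<Rightarrow> ('b \<Rightarrow> real)) \<Rightarrow> real" where
  "op_spectral_radius T = Max (cmod ` op_spectrum T)"

text \<open>The logarithm on \<open>[0, \<infinity>)\<close> with value \<open>-\<infinity>\<close> at 0.\<close>

definition ext_ln :: "real \<Rightarrow> ereal" where
  "ext_ln t = (if t = 0 then -\<infinity> else ereal (ln t))"

end

theory Submission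
  imports Defs "Jordan_Normal_Form.Spectral_Radius"
begin

text \<open>
  Write \<open>P\<close> for the transition operator, \<open>P f x = (\<Sum>y. p x y * f y)\<close>. The proof rests on an exact
  identity, not on an inequality: the common part \<open>min (p x) (p x')\<close> of two rows cancels in
  \<open>P f x - P f x'\<close>, and what is left is \<open>V\<close> applied to the function \<open>(a, b) \<mapsto> f a - f b\<close>
  (\<open>V_op_difference\<close>). The result again has the form \<open>(a, b) \<mapsto> g a - g b\<close>, with \<open>g = P f\<close>, so
  the identity iterates: \<open>P\<^sup>n f x - P\<^sup>n f x'\<close> is the value at \<open>(x, x')\<close> of
  \<open>V\<^sup>n\<close> applied to \<open>(a, b) \<mapsto> f a - f b\<close>.

  For \<open>f\<close> the indicator of \<open>A\<close>, averaging this over \<open>x'\<close> with weights \<open>\<mu> x'\<close> and using the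
  invariance of \<open>\<mu>\<close> turns the left-hand side into the discrepancy at \<open>A\<close> between the law of the
  chain at time \<open>n\<close> and \<open>\<mu>\<close> (\<open>markov_chain_diff_invariant\<close>). Hence the total variation distance is
  at most twice the supremum norm of \<open>V\<^sup>n\<close>.

  It remains to bound the powers of an operator on a finite-dimensional space by its spectral
  radius \<open>r\<close>. For every \<open>c > r\<close> the matrix of \<open>V / c\<close> has all eigenvalues inside the open unit
  disc, so by its Jordan normal form its powers are bounded, and the norm of \<open>V\<^sup>n\<close> is at most a
  constant times \<open>c\<^sup>n\<close> (\<open>kernel_op_power_bound\<close>). The exponential rate is therefore at most \<open>ln c\<close>
  for every \<open>c > r\<close>; letting \<open>c\<close> decrease to \<open>r\<close> gives the claim, with the value \<open>-\<infinity>\<close>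
  if \<open>r = 0\<close>.
\<close>

section \<open>Power bounds for operators on functions on a finite type\<close>

definition kernel_op :: "('b::finite \<Rightarrow> 'b \<Rightarrow> real) \<Rightarrow> ('b \<Rightarrow> real) \<Rightarrow> 'b \<Rightarrow> real" where
  "kernel_op K h = (\<lambda>s. \<Sum>t\<in>UNIV. K s t * h t)"

lemma complexification_kernel_op:
  "complexification (kernel_op K) h = (\<lambda>s. \<Sum>t\<in>UNIV. complex_of_real (K s t) * h t)"
  by (rule ext) (simp add: complexification_def kernel_op_def complex_eq_iff)

text \<open>The argument \<open>e\<close> numbers the elements of the index type; it transfers eigenvalue
  questions about \<open>kernel_op K\<close> to square complex matrices.\<close>

definition kernel_mat :: "(nat \<Rightarrow> 'b::finite) \<Rightarrow> ('b \<Rightarrow> 'b \<Rightarrow> real) \<Rightarrow> complex mat" where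
  "kernel_mat e K = mat CARD('b) CARD('b) (\<lambda>(i, j). complex_of_real (K (e i) (e j)))"

lemma kernel_mat_carrier [simp]:
  "kernel_mat (e :: nat \<Rightarrow> 'b::finite) K \<in> carrier_mat CARD('b) CARD('b)"
  by (simp add: kernel_mat_def)

lemma kernel_mat_mult_vec:
  fixes e :: "nat \<Rightarrow> 'b::finite"
  assumes e: "bij_betw e {..<CARD('b)} UNIV"
  shows "kernel_mat e K *\<^sub>v vec CARD('b) (\<lambda>i. h (e i)) =
    vec CARD('b) (\<lambda>i. complexification (kernel_op K) h (e i))"
proof (rule eq_vecI)
  fix i assume "i < dim_vec (vec CARD('b) (\<lambda>i. complexification (kernel_op K) h (e i)))"
  then have i: "i < CARD('b)" by simp
  have "(kernel_mat e K *\<^sub>v vec CARD('b) (\<lambda>i. h (e i))) $ i =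
      (\<Sum>j<CARD('b). complex_of_real (K (e i) (e j)) * h (e j))"
    using i by (simp add: kernel_mat_def scalar_prod_def lessThan_atLeast0)
  also have "\<dots> = (\<Sum>t\<in>UNIV. complex_of_real (K (e i) t) * h t)"
    by (rule sum.reindex_bij_betw[OF e])
  finally show "(kernel_mat e K *\<^sub>v vec CARD('b) (\<lambda>i. h (e i))) $ i =
      vec CARD('b) (\<lambda>i. complexification (kernel_op K) h (e i)) $ i"
    using i by (simp add: complexification_kernel_op)
qed (simp add: kernel_mat_def)

text \<open>Functions \<open>h\<close> on the index type and vectors of dimension \<open>CARD('b)\<close> correspond through
  \<open>i \<mapsto> h (e i)\<close>, so eigenfunctions and eigenvectors are the same thing.\<close>

lemma op_spectrum_kernel_op:
  fixes e :: "nat \<Rightarrow> 'b::finite"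
  assumes e: "bij_betw e {..<CARD('b)} UNIV"
  shows "op_spectrum (kernel_op K) = spectrum (kernel_mat e K)"
proof (intro equalityI subsetI)
  fix c assume "c \<in> op_spectrum (kernel_op K)"
  then obtain h s where h: "h s \<noteq> 0" "complexification (kernel_op K) h = (\<lambda>s. c * h s)"
    by (auto simp: op_spectrum_def fun_eq_iff)
  obtain i where i: "i < CARD('b)" "s = e i"
    using e by (metis UNIV_I bij_betw_iff_bijections lessThan_iff)
  define v where "v = vec CARD('b) (\<lambda>i. h (e i))"
  have "v $ i \<noteq> 0\<^sub>v CARD('b) $ i"
    using h i by (simp add: v_def)
  then have "v \<noteq> 0\<^sub>v CARD('b)" by metis
  moreover have "kernel_mat e K *\<^sub>v v = c \<cdot>\<^sub>v v"
    unfolding v_def kernel_mat_mult_vec[OF e] h(2) by auto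
  ultimately have "eigenvector (kernel_mat e K) v c"
    by (simp add: eigenvector_def v_def kernel_mat_def)
  then show "c \<in> spectrum (kernel_mat e K)"
    by (auto simp: spectrum_def eigenvalue_def)
next
  fix c assume "c \<in> spectrum (kernel_mat e K)"
  then obtain v where "eigenvector (kernel_mat e K) v c"
    by (auto simp: spectrum_def eigenvalue_def)
  then have v: "v \<in> carrier_vec CARD('b)" "v \<noteq> 0\<^sub>v CARD('b)" "kernel_mat e K *\<^sub>v v = c \<cdot>\<^sub>v v"
    by (auto simp: eigenvector_def kernel_mat_def)
  define h where "h s = v $ inv_into {..<CARD('b)} e s" for s
  have he: "h (e i) = v $ i" if "i < CARD('b)" for i
    using that e by (simp add: h_def bij_betw_def)
  then have vh: "v = vec CARD('b) (\<lambda>i. h (e i))"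
    using v(1) by auto
  have "complexification (kernel_op K) h s = c * h s" for s
  proof -
    obtain i where i: "i < CARD('b)" "s = e i"
      using e by (metis UNIV_I bij_betw_iff_bijections lessThan_iff)
    have "(kernel_mat e K *\<^sub>v v) $ i = (c \<cdot>\<^sub>v v) $ i"
      by (simp only: v(3))
    then show ?thesis
      unfolding vh kernel_mat_mult_vec[OF e] using i by simp
  qed
  moreover have "h \<noteq> (\<lambda>_. 0)"
    using v(2) vh by auto
  ultimately show "c \<in> op_spectrum (kernel_op K)"
    by (auto simp: op_spectrum_def)
qed

lemma kernel_mat_power_mult_vec:
  fixes e :: "nat \<Rightarrow> 'b::finite"
  assumes e: "bij_betw e {..<CARD('b)} UNIV"
  shows "(kernel_mat e K ^\<^sub>m n) *\<^sub>v vec CARD('b) (\<lambda>i. complex_of_real (h (e i))) =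
    vec CARD('b) (\<lambda>i. complex_of_real ((kernel_op K ^^ n) h (e i)))"
proof (induction n arbitrary: h)
  case 0
  show ?case by (simp add: kernel_mat_def)
next
  case (Suc n)
  let ?v = "vec CARD('b) (\<lambda>i. complex_of_real (h (e i)))"
  have "kernel_mat e K *\<^sub>v ?v = vec CARD('b) (\<lambda>i. complex_of_real (kernel_op K h (e i)))"
    using kernel_mat_mult_vec[OF e, of K "\<lambda>s. complex_of_real (h s)"]
    by (simp add: complexification_kernel_op kernel_op_def)
  then have "(kernel_mat e K ^\<^sub>m Suc n) *\<^sub>v ?v = (kernel_mat e K ^\<^sub>m n) *\<^sub>v
      vec CARD('b) (\<lambda>i. complex_of_real (kernel_op K h (e i)))"
    by (simp add: assoc_mult_mat_vec[of _ "CARD('b)" "CARD('b)" _ "CARD('b)"])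
  then show ?case
    by (simp add: Suc.IH funpow_swap1)
qed

lemma op_spectrum_kernel_op_divide:
  assumes "c \<noteq> 0" and "a \<in> op_spectrum (kernel_op (\<lambda>s t. K s t / c))"
  shows "of_real c * a \<in> op_spectrum (kernel_op K)"
proof -
  obtain h where h: "h \<noteq> (\<lambda>_. 0)"
    "complexification (kernel_op (\<lambda>s t. K s t / c)) h = (\<lambda>s. a * h s)"
    using assms(2) by (auto simp: op_spectrum_def)
  have "complexification (kernel_op K) h s = of_real c * a * h s" for s
  proof -
    have "complexification (kernel_op K) h s =
        of_real c * complexification (kernel_op (\<lambda>s t. K s t / c)) h s"
      using assms(1) by (simp add: complexification_kernel_op sum_distrib_left)
    then show ?thesis by (simp add: h(2))
  qed
  then show ?thesis
    using h(1) by (auto simp: op_spectrum_def)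
qed

lemma kernel_op_divide_power:
  "(kernel_op (\<lambda>s t. K s t / c) ^^ n) h = (\<lambda>s. (kernel_op K ^^ n) h s / c ^ n)"
  by (induction n) (simp_all add: kernel_op_def sum_divide_distrib mult.commute)

text \<open>The spectral radius is a maximum, which is meaningful because the spectrum is finite
  (roots of the characteristic polynomial) and nonempty (fundamental theorem of algebra).\<close>

lemma
  fixes K :: "'b::finite \<Rightarrow> 'b \<Rightarrow> real"
  shows op_spectrum_kernel_op_finite: "finite (op_spectrum (kernel_op K))"
    and op_spectral_radius_kernel_op_nonneg: "0 \<le> op_spectral_radius (kernel_op K)"
proof -
  obtain e :: "nat \<Rightarrow> 'b" where e: "bij_betw e {..<CARD('b)} UNIV"
    using ex_bij_betw_nat_finite[of "UNIV :: 'b set"] by (auto simp: lessThan_atLeast0)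
  show fin: "finite (op_spectrum (kernel_op K))"
    unfolding op_spectrum_kernel_op[OF e] by (rule card_finite_spectrum(1)[OF kernel_mat_carrier])
  obtain a where "a \<in> op_spectrum (kernel_op K)"
    unfolding op_spectrum_kernel_op[OF e]
    using spectrum_non_empty[OF kernel_mat_carrier, of e K] by auto
  then have "cmod a \<le> op_spectral_radius (kernel_op K)"
    using fin by (simp add: op_spectral_radius_def)
  then show "0 \<le> op_spectral_radius (kernel_op K)"
    using norm_ge_zero[of a] by linarith
qed

text \<open>This is the upper half of Gelfand's formula. Dividing the kernel by \<open>c\<close> moves all
  eigenvalues into the open unit disc; then the powers of every Jordan block stay bounded,
  and undoing the scaling costs the factor \<open>c ^ n\<close>. Since \<open>c\<close> is strictly above the spectral
  radius, it is positive even for a nilpotent operator.\<close>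

lemma kernel_op_power_bound:
  fixes K :: "'b::finite \<Rightarrow> 'b \<Rightarrow> real"
  assumes c: "op_spectral_radius (kernel_op K) < c"
  obtains C where "C > 0"
    and "\<And>n h s. (\<And>t. \<bar>h t\<bar> \<le> 1) \<Longrightarrow> \<bar>(kernel_op K ^^ n) h s\<bar> \<le> C * c ^ n"
proof -
  obtain e :: "nat \<Rightarrow> 'b" where e: "bij_betw e {..<CARD('b)} UNIV"
    using ex_bij_betw_nat_finite[of "UNIV :: 'b set"] by (auto simp: lessThan_atLeast0)
  have c0: "c > 0"
    using c op_spectral_radius_kernel_op_nonneg[of K] by linarith
  define A where "A = kernel_mat e (\<lambda>s t. K s t / c)"
  have A: "A \<in> carrier_mat CARD('b) CARD('b)"
    by (simp add: A_def)
  have "spectral_radius A < 1"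
  proof -
    obtain a where a: "a \<in> spectrum A" "spectral_radius A = cmod a"
      using spectral_radius_mem_max(1)[OF A] by auto
    have "of_real c * a \<in> op_spectrum (kernel_op K)"
      using a(1) c0 by (intro op_spectrum_kernel_op_divide)
        (simp_all add: A_def op_spectrum_kernel_op[OF e])
    then have "cmod (of_real c * a) \<le> op_spectral_radius (kernel_op K)"
      by (simp add: op_spectral_radius_def op_spectrum_kernel_op_finite)
    then have "c * cmod a < c * 1"
      using c c0 unfolding norm_mult norm_of_real by linarith
    then show ?thesis
      using c0 a(2) mult_less_cancel_left_pos[of c "cmod a" 1] by simp
  qed
  from spectral_radius_jnf_norm_bound_less_1_upper_triangular[OF A this]
  obtain b where b: "\<And>n. norm_bound (A ^\<^sub>m n) b" by auto
  \<comment> \<open>A row has \<open>CARD('b)\<close> entries, each at most \<open>b\<close> in modulus. The maximum with 1 makes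
    \<open>C\<close> positive, so that its logarithm can be taken later.\<close>
  define C where "C = CARD('b) * max b 1"
  have bound: "\<bar>(kernel_op K ^^ n) h s\<bar> \<le> C * c ^ n" if h: "\<And>t. \<bar>h t\<bar> \<le> 1" for n h s
  proof -
    obtain i where i: "i < CARD('b)" "s = e i"
      using e by (metis UNIV_I bij_betw_iff_bijections lessThan_iff)
    have An: "A ^\<^sub>m n \<in> carrier_mat CARD('b) CARD('b)"
      using A by simp
    have "complex_of_real ((kernel_op K ^^ n) h s / c ^ n) =
        (A ^\<^sub>m n *\<^sub>v vec CARD('b) (\<lambda>i. complex_of_real (h (e i)))) $ i"
      unfolding A_def kernel_mat_power_mult_vec[OF e]
      using i by (simp add: kernel_op_divide_power)
    also have "\<dots> = (\<Sum>j<CARD('b). (A ^\<^sub>m n) $$ (i, j) * complex_of_real (h (e j)))"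
      using i carrier_matD[OF A] carrier_matD[OF An]
      by (simp add: scalar_prod_def lessThan_atLeast0)
    finally have "\<bar>(kernel_op K ^^ n) h s / c ^ n\<bar> =
        cmod (\<Sum>j<CARD('b). (A ^\<^sub>m n) $$ (i, j) * complex_of_real (h (e j)))"
      by (metis norm_of_real)
    also have "\<dots> \<le> (\<Sum>j<CARD('b). max b 1 * 1)"
    proof (rule sum_norm_le)
      fix j assume j: "j \<in> {..<CARD('b)}"
      have "cmod ((A ^\<^sub>m n) $$ (i, j)) \<le> max b 1"
        using b[of n] carrier_matD[OF A] carrier_matD[OF An] i j
        by (auto simp: norm_bound_def intro: max.coboundedI1)
      then show "cmod ((A ^\<^sub>m n) $$ (i, j) * complex_of_real (h (e j))) \<le> max b 1 * 1"
        unfolding norm_mult norm_of_real using h by (intro mult_mono) auto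
    qed
    also have "\<dots> = C" by (simp add: C_def)
    finally show ?thesis
      using c0 by (simp add: abs_divide divide_le_eq)
  qed
  have "C > 0"
    by (simp add: C_def)
  with bound show ?thesis by (rule that[rotated])
qed

section \<open>The operator \<open>V\<close> on differences\<close>

definition residual_kernel :: "('a::finite \<Rightarrow> 'a pmf) \<Rightarrow> 'a \<times> 'a \<Rightarrow> 'a \<times> 'a \<Rightarrow> real" where
  "residual_kernel p = (\<lambda>(x, x') z. if overlap p x x' = 1 then 0 else
     (1 - overlap p x x') * pmf (pair_pmf (residual_pmf p x x') (residual_pmf p x' x)) z)"

lemma V_op_eq_kernel_op: "V_op p = kernel_op (residual_kernel p)"
proof (intro ext)
  fix h and z :: "'a \<times> 'a"
  show "V_op p h z = kernel_op (residual_kernel p) h z"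
    by (cases z) (auto simp: V_op_def kernel_op_def residual_kernel_def sum_distrib_left mult_ac
      integral_measure_pmf_real[where A = UNIV])
qed

abbreviation transition_op :: "('a::finite \<Rightarrow> 'a pmf) \<Rightarrow> ('a \<Rightarrow> real) \<Rightarrow> 'a \<Rightarrow> real" where
  "transition_op p \<equiv> kernel_op (\<lambda>x. pmf (p x))"

lemma overlap_le_1: "overlap p x x' \<le> 1"
proof -
  have "overlap p x x' \<le> (\<Sum>t\<in>UNIV. pmf (p x) t)"
    unfolding overlap_def by (intro sum_mono) simp
  then show ?thesis
    by (simp add: sum_pmf_eq_1)
qed

text \<open>If some state has \<open>p x t > p x' t\<close>, the minimum loses mass there and the overlap stays
  below the total mass 1 of \<open>p x\<close>.\<close>

lemma overlap_eq_1_iff: "overlap p x x' = 1 \<longleftrightarrow> p x = p x'"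
proof
  have le: "pmf (p x) t \<le> pmf (p x') t" if "overlap p x x' = 1" for x x' t
  proof (rule ccontr)
    assume "\<not> ?thesis"
    then have "overlap p x x' < (\<Sum>t\<in>UNIV. pmf (p x) t)"
      unfolding overlap_def by (intro sum_strict_mono_ex1) (auto intro!: exI[of _ t])
    then show False
      using that by (simp add: sum_pmf_eq_1)
  qed
  assume "overlap p x x' = 1"
  then show "p x = p x'"
    using le[of x x'] le[of x' x] by (intro pmf_eqI antisym) (simp_all add: overlap_commute)
qed (simp add: overlap_def sum_pmf_eq_1)

text \<open>The key identity. Integrating \<open>f a - f b\<close> against the product of the residual laws only
  sees their marginals. Multiplied by the factor \<open>1 - overlap p x x'\<close>, the marginals become
  \<open>p x - m\<close> and \<open>p x' - m\<close> with the same minimum \<open>m\<close>, which drops out of the difference. If the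
  overlap is 1 the rows of \<open>x\<close> and \<open>x'\<close> coincide and both sides vanish.\<close>

lemma V_op_difference:
  "V_op p (\<lambda>(a, b). f a - f b) = (\<lambda>(a, b). transition_op p f a - transition_op p f b)"
proof (rule ext, clarify)
  fix x x'
  show "V_op p (\<lambda>(a, b). f a - f b) (x, x') = transition_op p f x - transition_op p f x'"
  proof (cases "overlap p x x' = 1")
    case True
    then show ?thesis
      by (simp add: V_op_def overlap_eq_1_iff kernel_op_def)
  next
    case False
    define q where "q = 1 - overlap p x x'"
    have ov: "overlap p x x' < 1" "overlap p x' x < 1"
      using False overlap_le_1[of p x x'] by (auto simp: overlap_commute)
    then have q: "q > 0" by (simp add: q_def)
    define m where "m u = min (pmf (p x) u) (pmf (p x') u)" for u
    let ?r = "residual_pmf p x x'" and ?r' = "residual_pmf p x' x"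
    have r: "q * pmf ?r u = pmf (p x) u - m u" "q * pmf ?r' u = pmf (p x') u - m u" for u
      using q by (simp_all add: pmf_residual_pmf[OF ov(1)] pmf_residual_pmf[OF ov(2)]
        q_def m_def overlap_commute[of p x' x] min.commute)
    have "measure_pmf.expectation (pair_pmf ?r ?r') (\<lambda>(a, b). f a - f b) =
        measure_pmf.expectation (pair_pmf ?r ?r') (\<lambda>z. f (fst z) - f (snd z))"
      by (simp add: case_prod_unfold)
    also have "\<dots> = measure_pmf.expectation (map_pmf fst (pair_pmf ?r ?r')) f -
        measure_pmf.expectation (map_pmf snd (pair_pmf ?r ?r')) f"
      by (simp add: integrable_measure_pmf_finite del: map_fst_pair_pmf map_snd_pair_pmf)
    also have "\<dots> = (\<Sum>u\<in>UNIV. f u * pmf ?r u) - (\<Sum>u\<in>UNIV. f u * pmf ?r' u)"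
      by (simp add: map_fst_pair_pmf map_snd_pair_pmf integral_measure_pmf_real[where A = UNIV])
    finally have "V_op p (\<lambda>(a, b). f a - f b) (x, x') =
        (\<Sum>u\<in>UNIV. (q * pmf ?r u) * f u) - (\<Sum>u\<in>UNIV. (q * pmf ?r' u) * f u)"
      using False by (simp add: V_op_def q_def right_diff_distrib sum_distrib_left mult_ac)
    then show ?thesis
      by (simp add: r kernel_op_def left_diff_distrib sum_subtractf)
  qed
qed

lemma V_op_power_difference:
  "(V_op p ^^ n) (\<lambda>(a, b). f a - f b) =
     (\<lambda>(a, b). (transition_op p ^^ n) f a - (transition_op p ^^ n) f b)"
  by (induction n) (simp_all add: V_op_difference)

section \<open>The law of the chain\<close>

text \<open>The Markov property is given for complete trajectories, so the event \<open>X n = z\<close> is split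
  over all trajectories up to time \<open>n\<close> that end in \<open>z\<close>.\<close>

lemma markov_chain_step:
  fixes p :: "'a::finite \<Rightarrow> 'a pmf"
  assumes "markov_chain_from p x M X"
  shows "measure M {\<omega> \<in> space M. X (Suc n) \<omega> = y} =
    (\<Sum>z\<in>UNIV. measure M {\<omega> \<in> space M. X n \<omega> = z} * pmf (p z) y)"
proof -
  interpret prob_space M
    using assms by (simp add: markov_chain_from_def)
  have [measurable]: "X n \<in> M \<rightarrow>\<^sub>M count_space UNIV" for n
    using assms by (simp add: markov_chain_from_def)
  let ?S = "PiE {..n} (\<lambda>_. UNIV :: 'a set)"
  let ?path = "\<lambda>s. {\<omega> \<in> space M. \<forall>i\<le>n. X i \<omega> = s i}"
  have fin: "finite ?S"
    by (intro finite_PiE) auto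
  have disj: "disjoint_family_on ?path ?S"
  unfolding disjoint_family_on_def
  proof (intro ballI impI)
    fix s t assume st: "s \<in> ?S" "t \<in> ?S" "s \<noteq> t"
    have False if w: "w \<in> ?path s" "w \<in> ?path t" for w
    proof -
      have "s i = t i" if "i \<in> {..n}" for i
      proof -
        have "X i w = s i" "X i w = t i"
          using w that by blast+
        then show ?thesis by simp
      qed
      then have "s = t"
        by (rule PiE_ext[OF st(1,2)])
      with st(3) show False ..
    qed
    then show "?path s \<inter> ?path t = {}" by blast
  qed
  have cover: "restrict (\<lambda>i. X i \<omega>) {..n} \<in> ?S" for \<omega> by auto
  \<comment> \<open>The law of total probability for the partition by trajectories up to time \<open>n\<close>.\<close>
  have path_sum: "measure M {\<omega> \<in> space M. R \<omega>} =
      (\<Sum>s\<in>?S. measure M ({\<omega> \<in> space M. R \<omega>} \<inter> ?path s))"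
    if [measurable]: "Measurable.pred M R" for R
  proof -
    let ?E = "{\<omega> \<in> space M. R \<omega>}"
    have "?E = (\<Union>s\<in>?S. ?E \<inter> ?path s)"
    proof (intro equalityI subsetI)
      fix w assume "w \<in> ?E"
      then show "w \<in> (\<Union>s\<in>?S. ?E \<inter> ?path s)"
        by (intro UN_I[OF cover[of w]]) auto
    qed auto
    then have "measure M ?E = measure M (\<Union>s\<in>?S. ?E \<inter> ?path s)" by metis
    also have "\<dots> = (\<Sum>s\<in>?S. measure M (?E \<inter> ?path s))"
      using fin disj by (intro finite_measure_finite_Union) (auto simp: disjoint_family_on_def)
    finally show ?thesis .
  qed
  have "measure M {\<omega> \<in> space M. X (Suc n) \<omega> = y} =
      (\<Sum>s\<in>?S. measure M (?path s) * pmf (p (s n)) y)"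
  proof -
    have "measure M ({\<omega> \<in> space M. X (Suc n) \<omega> = y} \<inter> ?path s) =
        measure M (?path s) * pmf (p (s n)) y" for s
    proof -
      have "{\<omega> \<in> space M. X (Suc n) \<omega> = y} \<inter> ?path s =
          {\<omega> \<in> space M. \<forall>i\<le>Suc n. X i \<omega> = (s(Suc n := y)) i}"
        by (auto simp: le_Suc_eq)
      also have "measure M \<dots> = measure M {\<omega> \<in> space M. \<forall>i\<le>n. X i \<omega> = (s(Suc n := y)) i} *
          pmf (p ((s(Suc n := y)) n)) ((s(Suc n := y)) (Suc n))"
        using assms unfolding markov_chain_from_def by blast
      also have "{\<omega> \<in> space M. \<forall>i\<le>n. X i \<omega> = (s(Suc n := y)) i} = ?path s"
        by auto
      finally show ?thesis by simp
    qed
    then show ?thesis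
      using path_sum[of "\<lambda>\<omega>. X (Suc n) \<omega> = y"] by simp
  qed
  also have "\<dots> = (\<Sum>s\<in>?S. \<Sum>z\<in>UNIV. measure M ({\<omega> \<in> space M. X n \<omega> = z} \<inter> ?path s) * pmf (p z) y)"
  proof (rule sum.cong[OF refl])
    fix s
    have "{\<omega> \<in> space M. X n \<omega> = z} \<inter> ?path s = (if z = s n then ?path s else {})" for z
      by auto
    then have "measure M ({\<omega> \<in> space M. X n \<omega> = z} \<inter> ?path s) * pmf (p z) y =
        (if z = s n then measure M (?path s) * pmf (p z) y else 0)" for z
      by simp
    then show "measure M (?path s) * pmf (p (s n)) y =
        (\<Sum>z\<in>UNIV. measure M ({\<omega> \<in> space M. X n \<omega> = z} \<inter> ?path s) * pmf (p z) y)"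
      by simp
  qed
  also have "\<dots> = (\<Sum>z\<in>UNIV. measure M {\<omega> \<in> space M. X n \<omega> = z} * pmf (p z) y)"
  proof (subst sum.swap, rule sum.cong[OF refl])
    fix z
    show "(\<Sum>s\<in>?S. measure M ({\<omega> \<in> space M. X n \<omega> = z} \<inter> ?path s) * pmf (p z) y) =
        measure M {\<omega> \<in> space M. X n \<omega> = z} * pmf (p z) y"
      using path_sum[of "\<lambda>\<omega>. X n \<omega> = z"] by (simp add: sum_distrib_right[symmetric])
  qed
  finally show ?thesis .
qed

lemma markov_chain_expectation:
  fixes p :: "'a::finite \<Rightarrow> 'a pmf"
  assumes chain: "markov_chain_from p x M X"
  shows "(\<Sum>y\<in>UNIV. measure M {\<omega> \<in> space M. X n \<omega> = y} * f y) = (transition_op p ^^ n) f x"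
proof (induction n arbitrary: f)
  case 0
  interpret prob_space M
    using chain by (simp add: markov_chain_from_def)
  have [measurable]: "X n \<in> M \<rightarrow>\<^sub>M count_space UNIV" for n
    using chain by (simp add: markov_chain_from_def)
  have one: "prob {\<omega> \<in> space M. X 0 \<omega> = x} = 1"
    using chain by (simp add: markov_chain_from_def)
  then have "AE \<omega> in M. X 0 \<omega> = x"
    by (subst (asm) prob_Collect_eq_1) auto
  then have "prob {\<omega> \<in> space M. X 0 \<omega> = y} = (if y = x then 1 else 0)" for y
    using one by (auto intro!: prob_eq_0[THEN iffD2] elim!: AE_mp)
  then have "(\<Sum>y\<in>UNIV. prob {\<omega> \<in> space M. X 0 \<omega> = y} * f y) =
      (\<Sum>y\<in>UNIV. if y = x then f y else 0)"
    by (intro sum.cong refl) simp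
  then show ?case by simp
next
  case (Suc n)
  have "(\<Sum>y\<in>UNIV. measure M {\<omega> \<in> space M. X (Suc n) \<omega> = y} * f y) =
      (\<Sum>z\<in>UNIV. measure M {\<omega> \<in> space M. X n \<omega> = z} * transition_op p f z)"
    unfolding markov_chain_step[OF chain] kernel_op_def sum_distrib_left sum_distrib_right
    by (subst sum.swap) (simp add: mult.assoc)
  then show ?case
    by (simp add: Suc.IH funpow_swap1)
qed

lemma invariant_pmf_transition_op_power:
  assumes "invariant_pmf p \<mu>"
  shows "(\<Sum>y\<in>UNIV. pmf \<mu> y * (transition_op p ^^ n) f y) = (\<Sum>y\<in>UNIV. pmf \<mu> y * f y)"
proof (induction n)
  case (Suc n)
  have inv: "(\<Sum>z\<in>UNIV. pmf \<mu> z * pmf (p z) y) = pmf \<mu> y" for y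
  proof -
    have "pmf \<mu> y = pmf (bind_pmf \<mu> p) y"
      using assms by (simp add: invariant_pmf_def)
    then show ?thesis
      by (simp add: pmf_bind integral_measure_pmf_real[where A = UNIV] mult.commute)
  qed
  have "(\<Sum>z\<in>UNIV. pmf \<mu> z * transition_op p g z) = (\<Sum>y\<in>UNIV. pmf \<mu> y * g y)" for g
    unfolding kernel_op_def sum_distrib_left
    by (subst sum.swap)
      (simp add: mult.assoc[symmetric] sum_distrib_right[symmetric] inv)
  then show ?case by (simp add: Suc.IH)
qed simp

text \<open>Both measures of \<open>A\<close> are averages over \<open>y\<close> with weights \<open>\<mu> y\<close>: the first of the constant
  \<open>P\<^sup>n 1\<^sub>A x\<close>, the second, by invariance, of \<open>P\<^sup>n 1\<^sub>A y\<close>. Their difference is thus an average of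
  differences, to which \<open>V_op_power_difference\<close> applies.\<close>

lemma markov_chain_diff_invariant:
  assumes chain: "markov_chain_from p x M X" and inv: "invariant_pmf p \<mu>"
  shows "measure (distr M (count_space UNIV) (X n)) A - measure \<mu> A =
    (\<Sum>y\<in>UNIV. pmf \<mu> y * (V_op p ^^ n) (\<lambda>(a, b). indicator A a - indicator A b) (x, y))"
proof -
  interpret prob_space M
    using chain by (simp add: markov_chain_from_def)
  have X [measurable]: "X n \<in> M \<rightarrow>\<^sub>M count_space UNIV" for n
    using chain by (simp add: markov_chain_from_def)
  let ?f = "indicator A :: 'a \<Rightarrow> real"
  have "measure (distr M (count_space UNIV) (X n)) A =
      (\<Sum>y\<in>A. measure (distr M (count_space UNIV) (X n)) {y})"
    by (rule measure_eq_sum_singleton) (auto simp: emeasure_distr)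
  also have "\<dots> = (\<Sum>y\<in>A. measure M {\<omega> \<in> space M. X n \<omega> = y})"
    by (intro sum.cong refl) (auto simp: measure_distr vimage_def intro!: arg_cong[where f = "measure M"])
  also have "\<dots> = (\<Sum>y\<in>UNIV. measure M {\<omega> \<in> space M. X n \<omega> = y} * ?f y)"
    by (simp add: indicator_def sum.If_cases)
  also have "\<dots> = (transition_op p ^^ n) ?f x"
    by (rule markov_chain_expectation[OF chain])
  also have "\<dots> = (\<Sum>y\<in>UNIV. pmf \<mu> y * (transition_op p ^^ n) ?f x)"
    by (simp add: sum_distrib_right[symmetric] sum_pmf_eq_1)
  finally have 1: "measure (distr M (count_space UNIV) (X n)) A = \<dots>" .
  have "measure \<mu> A = (\<Sum>y\<in>UNIV. pmf \<mu> y * ?f y)"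
    by (simp add: measure_measure_pmf_finite indicator_def sum.If_cases)
  also have "\<dots> = (\<Sum>y\<in>UNIV. pmf \<mu> y * (transition_op p ^^ n) ?f y)"
    by (simp only: invariant_pmf_transition_op_power[OF inv])
  finally have 2: "measure \<mu> A = \<dots>" .
  show ?thesis
    unfolding 1 2 V_op_power_difference by (simp add: sum_subtractf right_diff_distrib)
qed

section \<open>Exponential rate of convergence\<close>

lemma tv_dist_nonneg:
  assumes "prob_space M" and "prob_space N"
  shows "0 \<le> tv_dist M N"
proof -
  have "bdd_above ((\<lambda>A. measure M A - measure N A) ` sets M)"
  proof (rule bdd_aboveI2[where M = 1])
    fix A
    show "measure M A - measure N A \<le> 1"
      using prob_space.prob_le_1[OF assms(1), of A] measure_nonneg[of N A] by linarith
  qed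
  then have "measure M {} - measure N {} \<le> (SUP A\<in>sets M. measure M A - measure N A)"
    by (intro cSUP_upper) auto
  then show ?thesis by (simp add: tv_dist_def)
qed

lemma tv_dist_geometric_bound:
  fixes p :: "'a::finite \<Rightarrow> 'a pmf"
  assumes chain: "markov_chain_from p x M X" and inv: "invariant_pmf p \<mu>"
    and c: "op_spectral_radius (V_op p) < c"
  obtains C where "C > 0"
    and "\<And>n. tv_dist (distr M (count_space UNIV) (X n)) \<mu> \<le> C * c ^ n"
proof -
  obtain C where C: "C > 0"
    "\<And>n h s. (\<And>t. \<bar>h t\<bar> \<le> 1) \<Longrightarrow> \<bar>(V_op p ^^ n) h s\<bar> \<le> C * c ^ n"
    using kernel_op_power_bound c unfolding V_op_eq_kernel_op by metis
  have "tv_dist (distr M (count_space UNIV) (X n)) \<mu> \<le> 2 * (C * c ^ n)" for n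
    unfolding tv_dist_def
  proof (intro mult_left_mono cSUP_least)
    fix A
    let ?h = "\<lambda>(a :: 'a, b). indicator A a - indicator A b :: real"
    have "\<bar>(V_op p ^^ n) ?h (x, y)\<bar> \<le> C * c ^ n" for y
      by (rule C(2)) (auto simp: indicator_def)
    then have "(\<Sum>y\<in>UNIV. pmf \<mu> y * (V_op p ^^ n) ?h (x, y)) \<le>
        (\<Sum>y\<in>UNIV. pmf \<mu> y * (C * c ^ n))"
      by (intro sum_mono mult_left_mono) (simp_all add: abs_le_iff)
    also have "\<dots> = C * c ^ n"
      by (simp add: sum_distrib_right[symmetric] sum_pmf_eq_1)
    finally show "measure (distr M (count_space UNIV) (X n)) A - measure \<mu> A \<le> C * c ^ n"
      by (simp add: markov_chain_diff_invariant[OF chain inv])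
  qed auto
  then show ?thesis
    using C(1) by (intro that[of "2 * C"]) (simp_all add: mult.assoc)
qed

text \<open>At times with \<open>d n = 0\<close> the term is \<open>-\<infinity>\<close>. The index 0 has to be left out because
  there the factor \<open>1 / real n\<close> is 0.\<close>

lemma limsup_log_rate_le:
  fixes d :: "nat \<Rightarrow> real"
  assumes d: "\<And>n. 0 \<le> d n" and C: "C > 0" and c: "c > 0" and bound: "\<And>n. d n \<le> C * c ^ n"
  shows "limsup (\<lambda>n. ereal (1 / real n) * ext_ln (d n)) \<le> ereal (ln c)"
proof -
  have "(\<lambda>n. ln C * (1 / real n) + ln c) \<longlonglongrightarrow> ln C * 0 + ln c"
    by (intro tendsto_intros lim_1_over_n)
  then have lim: "(\<lambda>n. ereal (ln C / real n + ln c)) \<longlonglongrightarrow> ereal (ln c)"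
    by simp
  have "limsup (\<lambda>n. ereal (1 / real n) * ext_ln (d n)) \<le>
      limsup (\<lambda>n. ereal (ln C / real n + ln c))"
  proof (rule Limsup_mono, rule eventually_mono[OF eventually_gt_at_top[of 0]])
    fix n :: nat assume n: "0 < n"
    show "ereal (1 / real n) * ext_ln (d n) \<le> ereal (ln C / real n + ln c)"
    proof (cases "d n = 0")
      case False
      then have "ln (d n) \<le> ln (C * c ^ n)"
        using bound[of n] d[of n] C c by (subst ln_le_cancel_iff) auto
      also have "\<dots> = ln C + n * ln c"
        using C c by (simp add: ln_mult ln_realpow)
      finally have "ln (d n) / n \<le> ln C / n + ln c"
        using n by (simp add: field_simps)
      with False show ?thesis by (simp add: ext_ln_def)
    qed (use n in \<open>simp add: ext_ln_def\<close>)
  qed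
  also have "\<dots> = ereal (ln c)"
    using lim by (intro lim_imp_Limsup) simp_all
  finally show ?thesis .
qed

text \<open>Away from \<open>0\<close> this is right continuity of the logarithm; at \<open>0\<close> the bounds \<open>ln c\<close> for
  \<open>c > 0\<close> exhaust all reals, which forces the value \<open>-\<infinity>\<close>.\<close>

lemma le_ext_lnI:
  assumes r: "0 \<le> r" and le: "\<And>c. r < c \<Longrightarrow> L \<le> ereal (ln c)"
  shows "L \<le> ext_ln r"
proof (cases "r = 0")
  case True
  have "L \<le> ereal B" for B
    using le[of "exp B"] True by simp
  then have "L = -\<infinity>"
    by (rule ereal_bot)
  then show ?thesis by simp
next
  case False
  have "((\<lambda>c. ereal (ln c)) \<longlongrightarrow> ereal (ln r)) (at_right r)"
    using False r by (intro tendsto_intros) auto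
  moreover have "\<forall>\<^sub>F c in at_right r. L \<le> ereal (ln c)"
    using eventually_at_right_less[of r] by (rule eventually_mono) (rule le)
  ultimately have "L \<le> ereal (ln r)"
    by (rule tendsto_lowerbound) simp
  then show ?thesis
    using False by (simp add: ext_ln_def)
qed

theorem theorem47:
  fixes p :: "'a::finite \<Rightarrow> 'a pmf"
    and P :: "'a \<Rightarrow> 'w measure"
    and X :: "nat \<Rightarrow> 'w \<Rightarrow> 'a"
    and \<mu> :: "'a pmf"
  assumes chain: "\<And>x. markov_chain_from p x (P x) X"
    and overlap_pos: "min_overlap p > 0"
    and invariant: "invariant_pmf p \<mu>"
  shows "\<forall>x. limsup (\<lambda>n. ereal (1 / real n) *
             ext_ln (tv_dist (distr (P x) (count_space UNIV) (X n)) (measure_pmf \<mu>)))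
           \<le> ext_ln (op_spectral_radius (V_op p))"
proof (intro allI le_ext_lnI)
  show r: "0 \<le> op_spectral_radius (V_op p)"
    by (simp add: V_op_eq_kernel_op op_spectral_radius_kernel_op_nonneg)
  fix x c assume c: "op_spectral_radius (V_op p) < c"
  obtain C where C: "C > 0"
    "\<And>n. tv_dist (distr (P x) (count_space UNIV) (X n)) \<mu> \<le> C * c ^ n"
    using tv_dist_geometric_bound[OF chain invariant c] by blast
  have "prob_space (distr (P x) (count_space UNIV) (X n))" for n
    using chain[of x] by (intro prob_space.prob_space_distr) (simp_all add: markov_chain_from_def)
  then have "0 \<le> tv_dist (distr (P x) (count_space UNIV) (X n)) \<mu>" for n
    by (intro tv_dist_nonneg prob_space_measure_pmf)
  then show "limsup (\<lambda>n. ereal (1 / real n) *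
      ext_ln (tv_dist (distr (P x) (count_space UNIV) (X n)) \<mu>)) \<le> ereal (ln c)"
    using C r c by (intro limsup_log_rate_le) auto
qed

end
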